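(* Let $\mathcal{M}$ be a $2$-rigidity family in which $K_{3,3}$ is not a circuit. Then every $\mathcal{M}$-circuit is an $\mathcal{R}$-circuit.
   Context: Graphs are identified with their edge sets. $\mathcal{R}$-independence: $G$ is $\mathcal{R}$-independent iff every set of $m\ge2$ of its vertices induces at most $2m-3$ edges; $\mathcal{R}$-circuits are minimal $\mathcal{R}$-dependent graphs. A matroidal family is a sequence $(\mathcal{M}_n)_{n\ge2}$ of matroids on $\binom{[n]}{2}$, each invariant under vertex relabelling, such that a graph $\mathcal{M}_n$-independent for some $n$ is $\mathcal{M}_n$-independent for all $n\ge v(G)$; a $2$-rigidity family is one with each $\mathcal{M}_n$ of rank $2n-3$. (In the paper's terminology: $\mathcal{M}$ has no short circuits, a short $\mathcal{M}$-circuit being an $\mathcal{M}$-circuit that is not an $\mathcal{R}$-circuit.) *)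

theory Defs
  imports Main "HOL-Combinatorics.Permutations"
begin

text \<open>Graphs are identified with their edge sets: a graph is a finite set of
  two-element sets, its vertex set is the union of its edges (so there are no
  isolated vertices).\<close>

definition graph :: "'a set set \<Rightarrow> bool" where
  "graph G \<longleftrightarrow> finite G \<and> (\<forall>e\<in>G. card e = 2)"

abbreviation verts :: "'a set set \<Rightarrow> 'a set" where
  "verts G \<equiv> \<Union>G"

definition relabel :: "('a \<Rightarrow> 'b) \<Rightarrow> 'a set set \<Rightarrow> 'b set set" where
  "relabel f G = (\<lambda>e. f ` e) ` G"

definition complete_graph :: "'a set \<Rightarrow> 'a set set" where
  "complete_graph X = {e. e \<subseteq> X \<and> card e = 2}"

definition K33 :: "nat set set" where
  "K33 = {{i, j} | i j. i \<in> {1, 2, 3} \<and> j \<in> {4, 5, 6}}"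

definition circuit :: "('a set set \<Rightarrow> bool) \<Rightarrow> 'a set set \<Rightarrow> bool" where
  "circuit indep C \<longleftrightarrow> graph C \<and> \<not> indep C \<and> (\<forall>D. D \<subset> C \<longrightarrow> indep D)"

definition R_indep :: "'a set set \<Rightarrow> bool" where
  "R_indep G \<longleftrightarrow>
     (\<forall>X \<subseteq> verts G. 2 \<le> card X \<longrightarrow> card {e \<in> G. e \<subseteq> X} \<le> 2 * card X - 3)"

locale matroid =
  fixes E :: "'e set" and indep :: "'e set \<Rightarrow> bool"
  assumes finite_ground: "finite E"
    and indep_subset_ground: "indep X \<Longrightarrow> X \<subseteq> E"
    and indep_empty: "indep {}"
    and indep_subset: "indep X \<Longrightarrow> Y \<subseteq> X \<Longrightarrow> indep Y"
    and augment: "indep X \<Longrightarrow> indep Y \<Longrightarrow> card X < card Y \<Longrightarrow>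
                    \<exists>y \<in> Y - X. indep (insert y X)"

definition matroid_rank :: "('e set \<Rightarrow> bool) \<Rightarrow> nat" where
  "matroid_rank indep = Max (card ` {X. indep X})"

text \<open>A sequence of matroids is given by their independence predicates: \<open>M n\<close>
  is the independence predicate of a matroid on the edge set of the complete graph
  on \<open>{1..n}\<close>; the values at \<open>n < 2\<close> are irrelevant. A graph on arbitrary vertices
  is independent in the \<open>n\<close>th matroid if it has an independent copy
  inside \<open>{1..n}\<close>; by invariance under relabelling the choice of the copy is
  immaterial.\<close>

definition indep_at :: "(nat \<Rightarrow> nat set set \<Rightarrow> bool) \<Rightarrow> nat \<Rightarrow> 'a set set \<Rightarrow> bool" where
  "indep_at M n G \<longleftrightarrow>
     (\<exists>f. inj_on f (verts G) \<and> f ` verts G \<subseteq> {1..n} \<and> M n (relabel f G))"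

definition family_indep :: "(nat \<Rightarrow> nat set set \<Rightarrow> bool) \<Rightarrow> 'a set set \<Rightarrow> bool" where
  "family_indep M G \<longleftrightarrow> (\<exists>n\<ge>2. indep_at M n G)"

definition matroidal_family :: "(nat \<Rightarrow> nat set set \<Rightarrow> bool) \<Rightarrow> bool" where
  "matroidal_family M \<longleftrightarrow>
     (\<forall>n\<ge>2. matroid (complete_graph {1..n}) (M n)) \<and>
     (\<forall>n\<ge>2. \<forall>\<pi>. \<pi> permutes {1..n} \<longrightarrow>
        (\<forall>G \<subseteq> complete_graph {1..n}. M n (relabel \<pi> G) \<longleftrightarrow> M n G)) \<and>
     (\<forall>G :: nat set set. graph G \<longrightarrow> (\<exists>n\<ge>2. indep_at M n G) \<longrightarrow>
        (\<forall>n\<ge>2. card (verts G) \<le> n \<longrightarrow> indep_at M n G))"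

definition two_rigidity_family :: "(nat \<Rightarrow> nat set set \<Rightarrow> bool) \<Rightarrow> bool" where
  "two_rigidity_family M \<longleftrightarrow>
     matroidal_family M \<and> (\<forall>n\<ge>2. matroid_rank (M n) = 2 * n - 3)"

end

theory Submission imports Defs begin

text \<open>Comparing ranks, every \<open>M\<close>-independent graph is \<open>R\<close>-independent; for the converse it
  suffices, by Henneberg's construction, that 0-extensions and 1-extensions preserve
  \<open>M\<close>-independence. For 0-extensions this follows from the ranks and symmetry. For 1-extensions,
  \<open>K33\<close> must be independent, hence a basis on its six vertices. Suppose that replacing an edge
  \<open>uv\<close> of an independent graph \<open>H\<close> by a vertex joined to \<open>u, v, w\<close> creates a dependency. Then three
  copies of this vertex together raise the rank of \<open>H - uv\<close> by only 6; but they form a \<open>K33\<close> with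
  \<open>u, v, w\<close>, so they span \<open>uv\<close> as well, and \<open>H\<close> with three 0-extensions has rank \<open>|H| + 6\<close>, one
  more than the span allows.\<close>

section \<open>Graphs and their relabellings\<close>

lemma relabel_relabel: "relabel g (relabel f G) = relabel (g \<circ> f) G"
  by (simp add: relabel_def image_image)

lemma relabel_cong: "(\<And>x. x \<in> verts G \<Longrightarrow> f x = g x) \<Longrightarrow> relabel f G = relabel g G"
  unfolding relabel_def by (intro image_cong refl) auto

lemma relabel_ident: "(\<And>x. x \<in> verts G \<Longrightarrow> f x = x) \<Longrightarrow> relabel f G = G"
  using relabel_cong[of G f id] by (simp add: relabel_def)

lemma relabel_insert: "relabel f (insert e G) = insert (f ` e) (relabel f G)"
  by (simp add: relabel_def)

lemma relabel_Un: "relabel f (G \<union> H) = relabel f G \<union> relabel f H"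
  by (simp add: relabel_def image_Un)

lemma relabel_mono: "G \<subseteq> H \<Longrightarrow> relabel f G \<subseteq> relabel f H"
  by (auto simp: relabel_def)

lemma verts_relabel: "verts (relabel f G) = f ` verts G"
  by (auto simp: relabel_def)

lemma inj_on_relabel: "inj_on f (verts G) \<Longrightarrow> inj_on (\<lambda>e. f ` e) G"
  by (rule inj_onI) (metis Union_upper inj_on_image_eq_iff)

lemma card_relabel: "inj_on f (verts G) \<Longrightarrow> card (relabel f G) = card G"
  unfolding relabel_def by (intro card_image inj_on_relabel)

lemma graph_subset: "graph G \<Longrightarrow> H \<subseteq> G \<Longrightarrow> graph H"
  by (auto simp: graph_def intro: finite_subset)

lemma finite_verts: "graph G \<Longrightarrow> finite (verts G)"
  unfolding graph_def by (metis card.infinite finite_Union zero_neq_numeral)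

lemma graph_relabel: "graph G \<Longrightarrow> inj_on f (verts G) \<Longrightarrow> graph (relabel f G)"
  by (auto simp: graph_def relabel_def card_image[OF inj_on_subset[OF _ Union_upper]])

lemma complete_graph_iff: "finite X \<Longrightarrow> G \<subseteq> complete_graph X \<longleftrightarrow> graph G \<and> verts G \<subseteq> X"
  unfolding complete_graph_def graph_def
  by (auto intro: finite_subset[of _ "Pow X"])

lemma finite_complete_graph: "finite X \<Longrightarrow> finite (complete_graph X)"
  unfolding complete_graph_def by (rule finite_subset[of _ "Pow X"]) auto

lemma card_verts_ge_2:
  assumes "graph G" "G \<noteq> {}"
  shows "2 \<le> card (verts G)"
proof -
  obtain e where "e \<in> G" using assms by auto
  then have "card e \<le> card (verts G)" using finite_verts[OF assms(1)]
    by (intro card_mono) auto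
  then show ?thesis using \<open>e \<in> G\<close> assms by (auto simp: graph_def)
qed

lemma extend_to_permutation:
  assumes S: "finite S" and A: "A \<subseteq> S" "inj_on f A" "f ` A \<subseteq> S"
  obtains p where "p permutes S" "\<And>x. x \<in> A \<Longrightarrow> p x = f x"
proof -
  have "card (S - A) = card (S - f ` A)"
    using assms by (simp add: card_Diff_subset finite_subset card_image)
  then obtain g where g: "bij_betw g (S - A) (S - f ` A)"
    using S by (metis finite_Diff finite_same_card_bij)
  have "bij_betw (\<lambda>x. if x \<in> A then f x else g x) (A \<union> (S - A)) (f ` A \<union> (S - f ` A))"
    using g A(2) by (intro bij_betw_disjoint_Un) (auto simp: bij_betw_def)
  moreover have "A \<union> (S - A) = S" "f ` A \<union> (S - f ` A) = S" using A by auto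
  ultimately have "bij_betw (\<lambda>x. if x \<in> A then f x else g x) S S" by simp
  then have "bij_betw (\<lambda>x. if x \<in> S then if x \<in> A then f x else g x else x) S S"
    by (subst bij_betw_cong[of S _ "\<lambda>x. if x \<in> A then f x else g x"]) auto
  then have "(\<lambda>x. if x \<in> S then if x \<in> A then f x else g x else x) permutes S"
    by (rule bij_imp_permutes) auto
  then show ?thesis by (rule that) (use A in auto)
qed

section \<open>Stars and the graph K33\<close>

text \<open>With \<open>z\<close> outside the graph, uniting with \<open>star z S\<close> attaches a
  new vertex: a 0-extension if \<open>S\<close> has two elements; with three, and an edge deleted, a
  1-extension.\<close>

definition star :: "'a \<Rightarrow> 'a set \<Rightarrow> 'a set set" where
  "star z S = (\<lambda>s. {z, s}) ` S"

lemma relabel_star: "relabel f (star z S) = star (f z) (f ` S)"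
  by (simp add: relabel_def star_def image_image)

lemma graph_star: "finite S \<Longrightarrow> z \<notin> S \<Longrightarrow> graph (star z S)"
  by (auto simp: graph_def star_def card_2_iff)

lemma finite_star: "finite S \<Longrightarrow> finite (star z S)"
  by (simp add: star_def)

lemma card_star: "card (star z S) = card S"
  unfolding star_def by (rule card_image) (auto simp: inj_on_def doubleton_eq_iff)

lemma graph_Un: "graph G \<Longrightarrow> graph H \<Longrightarrow> graph (G \<union> H)"
  by (auto simp: graph_def)

lemma star_decomposition:
  assumes "graph G"
  obtains S where "z \<notin> S" "finite S" "G = {e \<in> G. z \<notin> e} \<union> star z S" "card {e \<in> G. z \<in> e} = card S"
proof -
  define S where "S = {s. {z, s} \<in> G}"
  have z: "z \<notin> S" using assms by (auto simp: S_def graph_def)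
  have fin: "finite S" using finite_verts[OF assms] by (rule rev_finite_subset) (auto simp: S_def)
  have eq: "{e \<in> G. z \<in> e} = star z S"
  proof (rule subset_antisym)
    show "{e \<in> G. z \<in> e} \<subseteq> star z S"
    proof
      fix e assume e: "e \<in> {e \<in> G. z \<in> e}"
      then have "card e = 2" using assms by (auto simp: graph_def)
      then obtain a b where "e = {a, b}" by (metis card_2_iff)
      with e show "e \<in> star z S" by (auto simp: star_def S_def insert_commute)
    qed
  qed (auto simp: star_def S_def)
  have "G = {e \<in> G. z \<notin> e} \<union> star z S" using eq by auto
  then show ?thesis using that[of S] z fin eq by (simp add: card_star)
qed

text \<open>The form in which K33 appears in the 1-extension argument: three new vertices with the
  same three neighbours.\<close>

lemma K33_stars: "K33 = star 4 {1, 2, 3} \<union> star 5 {1, 2, 3} \<union> star 6 {1, 2, 3}"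
proof -
  have "{{i, j} | i j. i \<in> A \<and> j \<in> B} = (\<Union>j\<in>B. star j A)" for A B :: "nat set"
    unfolding star_def by (auto simp: insert_commute)
  from this[of "{1, 2, 3}" "{4, 5, 6}"] show ?thesis unfolding K33_def by (simp add: Un_assoc)
qed

lemma graph_K33: "graph K33"
  unfolding K33_stars by (intro graph_Un graph_star) auto

section \<open>Two-dimensional rigidity families\<close>

locale rigidity_family =
  fixes M :: "nat \<Rightarrow> nat set set \<Rightarrow> bool"
  assumes family: "two_rigidity_family M"
begin

section \<open>Matroid axioms and rank on arbitrary vertex sets\<close>

lemma matroid_M: "2 \<le> n \<Longrightarrow> matroid (complete_graph {1..n}) (M n)"
  using family by (auto simp: two_rigidity_family_def matroidal_family_def)

lemma M_relabel:
  assumes n: "2 \<le> n" and G: "G \<subseteq> complete_graph {1..n}"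
    and f: "inj_on f (verts G)" "f ` verts G \<subseteq> {1..n}"
  shows "M n (relabel f G) \<longleftrightarrow> M n G"
proof -
  have "verts G \<subseteq> {1..n}" using G by (auto simp: complete_graph_def)
  then obtain p where p: "p permutes {1..n}" "\<And>x. x \<in> verts G \<Longrightarrow> p x = f x"
    using extend_to_permutation[of "{1..n}" "verts G" f] f by auto
  have "M n (relabel p G) \<longleftrightarrow> M n G"
    using family n G p(1) by (auto simp: two_rigidity_family_def matroidal_family_def)
  then show ?thesis using relabel_cong[of G p f] p(2) by simp
qed

text \<open>The existential choices of \<open>n\<close> and of the embedding are immaterial:
  persistence in the family changes \<open>m\<close> to \<open>n\<close>, and symmetry then relates
  any two copies inside \<open>{1..n}\<close>.\<close>

lemma family_indep_iff:
  fixes G :: "'a set set"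
  assumes n: "2 \<le> n" and G: "graph G" and f: "inj_on f (verts G)" "f ` verts G \<subseteq> {1..n}"
  shows "family_indep M G \<longleftrightarrow> M n (relabel f G)"
proof
  assume "M n (relabel f G)"
  then show "family_indep M G" using n f by (auto simp: family_indep_def indep_at_def)
next
  assume "family_indep M G"
  then obtain m g where m: "2 \<le> m" and g: "inj_on g (verts G)" "g ` verts G \<subseteq> {1..m}"
    and Mm: "M m (relabel g G)"
    by (auto simp: family_indep_def indep_at_def)
  \<comment> \<open>Persistence is postulated only for graphs on \<open>nat\<close>, so it is
    applied to the copy \<open>relabel g G\<close> instead of \<open>G\<close>.\<close>
  have "indep_at M m (relabel g G)"
    unfolding indep_at_def using Mm g
    by (intro exI[of _ id]) (auto simp: verts_relabel relabel_ident)
  moreover have "card (verts (relabel g G)) \<le> n"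
    using card_image[OF g(1)] card_image[OF f(1)] card_mono[OF _ f(2)] by (simp add: verts_relabel)
  ultimately have "indep_at M n (relabel g G)"
    using family m n graph_relabel[OF G g(1)]
    unfolding two_rigidity_family_def matroidal_family_def by blast
  then obtain h where h: "inj_on h (g ` verts G)" "h ` g ` verts G \<subseteq> {1..n}"
    and Mn: "M n (relabel (h \<circ> g) G)"
    by (auto simp: indep_at_def verts_relabel relabel_relabel)
  define q where "q = h \<circ> g"
  have q: "inj_on q (verts G)" "q ` verts G \<subseteq> {1..n}"
    using g h by (simp_all add: q_def comp_inj_on image_comp)
  \<comment> \<open>\<open>k\<close> carries the copy of \<open>G\<close> under \<open>q\<close> to
    its copy under \<open>f\<close>.\<close>
  define k where "k = f \<circ> inv_into (verts G) q"
  have kq: "k (q x) = f x" if "x \<in> verts G" for x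
    using q that by (simp add: k_def)
  have "relabel k (relabel q G) = relabel f G"
    unfolding relabel_relabel by (rule relabel_cong) (simp add: kq)
  moreover have "M n (relabel k (relabel q G)) \<longleftrightarrow> M n (relabel q G)"
  proof (rule M_relabel[OF n])
    show "relabel q G \<subseteq> complete_graph {1..n}"
      using graph_relabel[OF G q(1)] q(2) by (simp add: complete_graph_iff verts_relabel)
    show "inj_on k (verts (relabel q G))"
      unfolding verts_relabel using f(1) by (auto simp: kq inj_on_def)
    show "k ` verts (relabel q G) \<subseteq> {1..n}"
      unfolding verts_relabel using f(2) kq by auto
  qed
  ultimately show "M n (relabel f G)" using Mn by (simp add: q_def)
qed

lemma family_indep_relabel:
  fixes G :: "'a set set" and f :: "'a \<Rightarrow> 'b"
  assumes G: "graph G" and f: "inj_on f (verts G)"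
  shows "family_indep M (relabel f G) \<longleftrightarrow> family_indep M G"
proof -
  obtain g where g: "bij_betw g (f ` verts G) {1..card (f ` verts G)}"
    using ex_bij_betw_finite_nat[of "f ` verts G"] finite_verts[OF G]
    by (metis finite_imageI finite_same_card_bij finite_atLeastAtMost card_atLeastAtMost diff_Suc_1)
  \<comment> \<open>The summand 2 keeps \<open>n\<close> in the range of the axioms even for the
    empty graph.\<close>
  define n where "n = card (f ` verts G) + 2"
  have g': "inj_on g (f ` verts G)" "g ` f ` verts G \<subseteq> {1..n}"
    using g by (auto simp: bij_betw_def n_def)
  have "family_indep M (relabel f G) \<longleftrightarrow> M n (relabel g (relabel f G))"
    using g' by (intro family_indep_iff graph_relabel G f) (auto simp: n_def verts_relabel)
  moreover have "family_indep M G \<longleftrightarrow> M n (relabel (g \<circ> f) G)"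
    using g' f by (intro family_indep_iff G comp_inj_on) (auto simp: n_def)
  ultimately show ?thesis by (simp add: relabel_relabel)
qed

text \<open>A single bijection serves all graphs on \<open>X\<close>, so that several of them can be
  compared inside the same matroid \<open>M n\<close>. The axioms and the rank are pulled back
  through it.\<close>

lemma transport:
  fixes X :: "'a set"
  assumes "finite X" "card X = n" "2 \<le> n"
  obtains f where "bij_betw f X {1..n}"
    "\<And>G. G \<subseteq> complete_graph X \<Longrightarrow> family_indep M G \<longleftrightarrow> M n (relabel f G)"
proof -
  obtain f where f: "bij_betw f X {1..n}"
    using assms by (metis finite_same_card_bij finite_atLeastAtMost card_atLeastAtMost diff_Suc_1)
  have "family_indep M G \<longleftrightarrow> M n (relabel f G)" if "G \<subseteq> complete_graph X" for G
  proof -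
    have G: "graph G" "verts G \<subseteq> X" using that complete_graph_iff[OF assms(1)] by auto
    then show ?thesis using f assms
      by (intro family_indep_iff) (auto simp: bij_betw_def intro: inj_on_subset)
  qed
  then show ?thesis using that f by blast
qed

lemma family_indep_subset:
  assumes "graph G" "family_indep M G" "H \<subseteq> G"
  shows "family_indep M H"
proof -
  obtain n f where n: "2 \<le> n" and f: "inj_on f (verts G)" "f ` verts G \<subseteq> {1..n}"
    and MG: "M n (relabel f G)"
    using assms(2) by (auto simp: family_indep_def indep_at_def)
  have "M n (relabel f H)"
    using matroid.indep_subset[OF matroid_M[OF n] MG] relabel_mono[OF assms(3)] by blast
  moreover have "verts H \<subseteq> verts G" using assms(3) by blast
  ultimately show ?thesis
    unfolding family_indep_def indep_at_def using n f
    by (meson dual_order.trans image_mono inj_on_subset)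
qed

lemma family_indep_empty: "family_indep M {}"
  unfolding family_indep_def indep_at_def
  using matroid.indep_empty[OF matroid_M[of 2]] by (intro exI[of _ 2]) (auto simp: relabel_def)

lemma family_indep_augment:
  fixes G H :: "'a set set"
  assumes G: "graph G" "family_indep M G" and H: "graph H" "family_indep M H"
    and less: "card G < card H"
  obtains e where "e \<in> H - G" "family_indep M (insert e G)"
proof -
  define X where "X = verts G \<union> verts H"
  have fin: "finite X" using finite_verts G H by (auto simp: X_def)
  have "card (verts H) \<le> card X" by (rule card_mono[OF fin]) (auto simp: X_def)
  moreover have "H \<noteq> {}" using less by auto
  ultimately have two: "2 \<le> card X" using card_verts_ge_2[OF H(1)] by linarith
  obtain f where f: "bij_betw f X {1..card X}"
    "\<And>G. G \<subseteq> complete_graph X \<Longrightarrow> family_indep M G \<longleftrightarrow> M (card X) (relabel f G)"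
    using transport[OF fin refl two] by blast
  have sub: "G \<subseteq> complete_graph X" "H \<subseteq> complete_graph X"
    using G H complete_graph_iff[OF fin] by (auto simp: X_def)
  have inj: "inj_on f (verts G)" "inj_on f (verts H)"
    using f(1) by (auto simp: bij_betw_def X_def intro: inj_on_subset)
  obtain y where y: "y \<in> relabel f H - relabel f G" "M (card X) (insert y (relabel f G))"
    using matroid.augment[OF matroid_M[OF two], of "relabel f G" "relabel f H"]
      f(2) sub G H less inj by (auto simp: card_relabel)
  then obtain e where e: "e \<in> H - G" "y = f ` e" by (auto simp: relabel_def)
  have "insert e G \<subseteq> complete_graph X" using e sub by auto
  then have "family_indep M (insert e G)" using f(2) y e by (simp add: relabel_insert)
  then show ?thesis using that e by blast
qed

text \<open>Repeated augmentation of \<open>G\<close> by edges of \<open>H\<close>, until the size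
  of \<open>H\<close> is reached. The later rank arguments use only this bound on the size, not
  maximality of \<open>B\<close>.\<close>

lemma family_indep_extend:
  fixes G H :: "'a set set"
  assumes G: "graph G" "family_indep M G" and H: "graph H" "family_indep M H"
  obtains B where "G \<subseteq> B" "B \<subseteq> G \<union> H" "family_indep M B" "card H \<le> card B"
proof -
  have "\<exists>B. G \<subseteq> B \<and> B \<subseteq> G \<union> H \<and> family_indep M B \<and> card H \<le> card B"
    using G
  proof (induction "card H - card G" arbitrary: G)
    case 0
    then show ?case by (intro exI[of _ G]) auto
  next
    case (Suc k)
    then obtain e where e: "e \<in> H - G" "family_indep M (insert e G)"
      using family_indep_augment[OF Suc.prems H] by (metis zero_less_Suc zero_less_diff)
    have "graph (insert e G)" using Suc.prems H e by (auto simp: graph_def)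
    moreover have "k = card H - card (insert e G)"
      using Suc e by (auto simp: graph_def)
    ultimately obtain B where "insert e G \<subseteq> B" "B \<subseteq> insert e G \<union> H" "family_indep M B" "card H \<le> card B"
      using Suc(1)[of "insert e G"] e by blast
    then show ?case using e by (intro exI[of _ B]) auto
  qed
  then show ?thesis using that by blast
qed

lemma rank_M: "2 \<le> n \<Longrightarrow> Max (card ` {X. M n X}) = 2 * n - 3"
  using family by (simp add: two_rigidity_family_def matroid_rank_def)

lemma finite_card_M:
  assumes "2 \<le> n"
  shows "finite (card ` {X. M n X})"
proof -
  have "{X. M n X} \<subseteq> Pow (complete_graph {1..n})"
    using matroid.indep_subset_ground[OF matroid_M[OF assms]] by auto
  then show ?thesis
    by (intro finite_imageI) (auto elim!: finite_subset simp: finite_complete_graph)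
qed

lemma card_family_indep_le:
  fixes X :: "'a set"
  assumes "finite X" "2 \<le> card X" "G \<subseteq> complete_graph X" "family_indep M G"
  shows "card G \<le> 2 * card X - 3"
proof -
  obtain f where f: "bij_betw f X {1..card X}"
    "\<And>G. G \<subseteq> complete_graph X \<Longrightarrow> family_indep M G \<longleftrightarrow> M (card X) (relabel f G)"
    using transport[OF assms(1) refl assms(2)] by blast
  have "verts G \<subseteq> X" using assms complete_graph_iff by blast
  then have "card (relabel f G) = card G"
    using f(1) by (intro card_relabel) (auto simp: bij_betw_def intro: inj_on_subset)
  moreover have "M (card X) (relabel f G)" using f(2) assms by blast
  then have "card (relabel f G) \<le> Max (card ` {Y. M (card X) Y})"
    by (intro Max_ge finite_card_M assms imageI) simp
  ultimately show ?thesis using rank_M[OF assms(2)] by simp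
qed

lemma basis_exists:
  fixes X :: "'a set"
  assumes X: "finite X" "2 \<le> card X"
  obtains B where "B \<subseteq> complete_graph X" "family_indep M B" "card B = 2 * card X - 3"
proof -
  obtain f where f: "bij_betw f X {1..card X}"
    "\<And>G. G \<subseteq> complete_graph X \<Longrightarrow> family_indep M G \<longleftrightarrow> M (card X) (relabel f G)"
    using transport[OF X(1) refl X(2)] by blast
  have "Max (card ` {Y. M (card X) Y}) \<in> card ` {Y. M (card X) Y}"
    using matroid.indep_empty[OF matroid_M[OF X(2)]] by (intro Max_in finite_card_M[OF X(2)]) auto
  then obtain Y where Y: "M (card X) Y" "card Y = 2 * card X - 3"
    using rank_M[OF X(2)] by auto
  then have Ysub: "Y \<subseteq> complete_graph {1..card X}"
    using matroid.indep_subset_ground[OF matroid_M[OF X(2)]] by blast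
  then have gY: "graph Y" and vY: "verts Y \<subseteq> {1..card X}"
    using complete_graph_iff[of "{1..card X}" Y] by auto
  define g where "g = inv_into X f"
  have g: "bij_betw g {1..card X} X" unfolding g_def using f(1) by (rule bij_betw_inv_into)
  have fg: "f (g y) = y" if "y \<in> verts Y" for y
    using f(1) that vY unfolding g_def by (metis bij_betw_inv_into_right subsetD)
  have inj: "inj_on g (verts Y)" using g vY by (auto simp: bij_betw_def intro: inj_on_subset)
  have "relabel f (relabel g Y) = Y"
    unfolding relabel_relabel by (rule relabel_ident) (simp add: fg)
  moreover have "relabel g Y \<subseteq> complete_graph X"
    using complete_graph_iff[OF X(1)] graph_relabel[OF gY inj] vY g
    by (auto simp: verts_relabel bij_betw_def)
  ultimately show ?thesis
    using that[of "relabel g Y"] f(2) Y card_relabel[OF inj] by simp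
qed

section \<open>0-extensions\<close>

lemma zero_extension_card_2:
  fixes G :: "'a set set"
  assumes G: "graph G" "family_indep M G" and z: "z \<notin> verts G" "z \<notin> S" and S: "card S = 2"
  shows "family_indep M (G \<union> star z S)"
proof -
  define X where "X = verts G \<union> S"
  have finS: "finite S" using S by (simp add: card_ge_0_finite)
  have finX: "finite X" using finite_verts[OF G(1)] finS by (simp add: X_def)
  have zX: "z \<notin> X" using z by (simp add: X_def)
  have "card S \<le> card X" by (rule card_mono[OF finX]) (simp add: X_def)
  then have X2: "2 \<le> card X" using S by simp
  let ?Y = "insert z X"
  have finY: "finite ?Y" and cardY: "card ?Y = Suc (card X)" and Y2: "2 \<le> card ?Y"
    using finX zX X2 by auto
  have away_le: "card {e \<in> E. z \<notin> e} \<le> 2 * card X - 3"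
    if "E \<subseteq> complete_graph ?Y" "family_indep M E" for E
  proof (rule card_family_indep_le[OF finX X2])
    show "{e \<in> E. z \<notin> e} \<subseteq> complete_graph X"
      using that by (auto simp: complete_graph_def)
    show "family_indep M {e \<in> E. z \<notin> e}"
      by (rule family_indep_subset[OF iffD1[OF complete_graph_iff[OF finY] that(1), THEN conjunct1] that(2)]) auto
  qed
  \<comment> \<open>Passing from \<open>X\<close> to \<open>insert z X\<close> raises the rank by
    two, from \<open>2 * card X - 3\<close> to \<open>2 * card X - 1\<close>. The edges avoiding
    \<open>z\<close> are independent on \<open>X\<close>, so a graph attaining the larger rank has
    at least two edges at \<open>z\<close>.\<close>
  have at_least_two: "2 \<le> card {e \<in> E. z \<in> e}"
    if E: "E \<subseteq> complete_graph ?Y" "family_indep M E" and "2 * card X - 1 \<le> card E" for E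
  proof -
    have "finite E" using E(1) finite_complete_graph[OF finY] by (rule finite_subset)
    then have "card E = card {e \<in> E. z \<notin> e} + card {e \<in> E. z \<in> e}"
      by (subst card_Un_disjoint[symmetric]) (auto intro: arg_cong[where f = card])
    then show ?thesis using away_le[OF E] that(3) X2 by linarith
  qed
  \<comment> \<open>Extending a basis on \<open>X\<close> yields a 0-extension at some pair \<open>T\<close>; a permutation of \<open>X\<close> moves \<open>T\<close>
    to \<open>S\<close>, and the new basis is then exchanged for \<open>G\<close>.\<close>
  obtain B where B: "B \<subseteq> complete_graph X" "family_indep M B" "card B = 2 * card X - 3"
    using basis_exists[OF finX X2] by blast
  obtain B1 where B1: "B1 \<subseteq> complete_graph ?Y" "family_indep M B1" "card B1 = 2 * card ?Y - 3"
    using basis_exists[OF finY Y2] by blast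
  have BY: "B \<subseteq> complete_graph ?Y" using B(1) by (auto simp: complete_graph_def)
  have graphs: "graph B" "graph B1" "verts B \<subseteq> X" using B B1 complete_graph_iff finX finY by blast+
  obtain E where E: "B \<subseteq> E" "E \<subseteq> B \<union> B1" "family_indep M E" "card B1 \<le> card E"
    using family_indep_extend[OF graphs(1) B(2) graphs(2) B1(2)] by blast
  have EY: "E \<subseteq> complete_graph ?Y" using E(2) BY B1(1) by blast
  then have gE: "graph E" using complete_graph_iff[OF finY] by blast
  have "2 \<le> card {e \<in> E. z \<in> e}"
    by (rule at_least_two[OF EY E(3)]) (use E(4) B1(3) cardY in simp)
  moreover obtain T0 where T0: "z \<notin> T0" "finite T0" "E = {e \<in> E. z \<notin> e} \<union> star z T0"
    "card {e \<in> E. z \<in> e} = card T0"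
    using star_decomposition[OF gE, of z] .
  ultimately obtain T where T: "T \<subseteq> T0" "card T = 2" "finite T"
    using obtain_subset_with_card_n[of 2 T0] by metis
  have starT: "star z T \<subseteq> E" using T0(3) T(1) by (auto simp: star_def)
  have TX: "T \<subseteq> X"
  proof
    fix t assume t: "t \<in> T"
    then have "{z, t} \<in> complete_graph ?Y" using starT EY by (auto simp: star_def)
    then show "t \<in> X" using t T(1) T0(1) by (auto simp: complete_graph_def)
  qed
  obtain h where h: "bij_betw h T S" using T S finS by (metis finite_same_card_bij)
  obtain p where p: "p permutes X" "\<And>x. x \<in> T \<Longrightarrow> p x = h x"
    using extend_to_permutation[OF finX TX, of h] h by (auto simp: bij_betw_def X_def)
  have pT: "p ` T = S" using p(2) h by (simp add: bij_betw_def)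
  have pz: "p z = z" using p(1) zX by (simp add: permutes_not_in)
  have injp: "inj_on p A" for A using p(1) by (meson inj_on_subset permutes_inj top_greatest)
  define I where "I = relabel p B \<union> star z S"
  have I_eq: "I = relabel p (B \<union> star z T)"
    by (simp add: I_def relabel_Un relabel_star pz pT)
  have gBT: "graph (B \<union> star z T)" using starT E(1) gE by (auto intro: graph_subset)
  have "family_indep M (B \<union> star z T)"
    using starT E by (intro family_indep_subset[OF gE E(3)]) auto
  then have indI: "family_indep M I" unfolding I_eq using family_indep_relabel[OF gBT injp] by simp
  have gI: "graph I" unfolding I_eq by (rule graph_relabel[OF gBT injp])
  have BX: "relabel p B \<subseteq> complete_graph X"
    using complete_graph_iff[OF finX] graph_relabel[OF graphs(1) injp] graphs(3) permutes_image[OF p(1)]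
    by (auto simp: verts_relabel)
  have "card I = 2 * card X - 1"
    unfolding I_def using BX zX card_star[of z S] S B(3) card_relabel[OF injp, of B] X2 finX finS graphs(1)
    by (subst card_Un_disjoint) (auto simp: complete_graph_def star_def graph_def relabel_def)
  obtain F where F: "G \<subseteq> F" "F \<subseteq> G \<union> I" "family_indep M F" "card I \<le> card F"
    using family_indep_extend[OF G gI indI] by blast
  have "G \<subseteq> complete_graph ?Y" using G(1) complete_graph_iff[OF finY] by (auto simp: X_def)
  moreover have "I \<subseteq> complete_graph ?Y"
    using BX graph_star[OF finS z(2)] by (auto simp: I_def complete_graph_def graph_def star_def X_def)
  ultimately have FY: "F \<subseteq> complete_graph ?Y" using F(2) by blast
  \<comment> \<open>\<open>G\<close> has no edge at \<open>z\<close>, so those of \<open>F\<close>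
    all come from \<open>I\<close>. As \<open>F\<close> still attains the rank, it must contain both
    edges of \<open>star z S\<close>.\<close>
  have sub: "{e \<in> F. z \<in> e} \<subseteq> star z S"
    using F(2) z(1) BX zX by (auto simp: I_def complete_graph_def)
  have "2 \<le> card {e \<in> F. z \<in> e}"
    by (rule at_least_two[OF FY F(3)]) (use F(4) \<open>card I = _\<close> in simp)
  then have "{e \<in> F. z \<in> e} = star z S"
    using sub card_star[of z S] S finS by (intro card_subset_eq) (auto simp: star_def dest: card_mono[rotated])
  then show ?thesis
    using F(1) by (intro family_indep_subset[OF iffD1[OF complete_graph_iff[OF finY] FY, THEN conjunct1] F(3)]) auto
qed

text \<open>Fewer than two neighbours are padded to two and the surplus edges are discarded
  afterwards. Working over \<open>nat\<close> guarantees vertices for the padding.\<close>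

lemma zero_extension:
  fixes G :: "nat set set"
  assumes G: "graph G" "family_indep M G" and z: "z \<notin> verts G" "z \<notin> S"
    and S: "finite S" "card S \<le> 2"
  shows "family_indep M (G \<union> star z S)"
proof -
  have "infinite (UNIV - insert z S)" using S by (simp add: Diff_infinite_finite)
  then obtain T where T: "finite T" "card T = 2 - card S" "T \<subseteq> UNIV - insert z S"
    using infinite_arbitrarily_large by blast
  define S' where "S' = S \<union> T"
  have "card S' = card S + card T"
    unfolding S'_def using S T by (intro card_Un_disjoint) auto
  then have S': "S \<subseteq> S'" "z \<notin> S'" "card S' = 2" "finite S'"
    using S T z(2) by (auto simp: S'_def)
  have "family_indep M (G \<union> star z S')"
    using S' by (intro zero_extension_card_2 G z) auto
  moreover have "graph (G \<union> star z S')"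
    using S' by (intro graph_Un G graph_star) auto
  moreover have "star z S \<subseteq> star z S'" using S' by (auto simp: star_def)
  ultimately show ?thesis by (meson Un_mono family_indep_subset subset_refl)
qed

section \<open>K33 and 1-extensions\<close>

text \<open>Not being a circuit would still allow K33 to be dependent through a proper subgraph.
  This is excluded because K33 minus an edge \<open>{i, j}\<close> arises from the empty graph by
  0-extensions: join 4, 5, 6 to the two vertices of \<open>P\<close>, then join \<open>i\<close> to
  the two vertices of \<open>Q\<close>.\<close>

lemma K33_indep:
  assumes "\<not> circuit (family_indep M) K33"
  shows "family_indep M K33"
proof -
  have "family_indep M D" if D: "D \<subset> K33" for D
  proof -
    obtain i j :: nat where ij: "i \<in> {1, 2, 3}" "j \<in> {4, 5, 6}" "{i, j} \<notin> D"
      using D unfolding K33_def by blast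
    define P where "P = {1, 2, 3} - {i}"
    define Q where "Q = {4, 5, 6} - {j}"
    have P: "finite P" "card P \<le> 2" "P \<subseteq> {1, 2, 3}" "i \<notin> P"
      using ij(1) by (auto simp: P_def)
    have Q: "finite Q" "card Q \<le> 2" "Q \<subseteq> {4, 5, 6}" using ij(2) by (auto simp: Q_def)
    define G1 where "G1 = {} \<union> star 4 P"
    define G2 where "G2 = G1 \<union> star 5 P"
    define G3 where "G3 = G2 \<union> star 6 P"
    define G4 where "G4 = G3 \<union> star i Q"
    have nP: "4 \<notin> P" "5 \<notin> P" "6 \<notin> P" "i \<notin> Q" using P Q ij by auto
    have g: "graph G1" "graph G2" "graph G3" "graph G4"
      unfolding G4_def G3_def G2_def G1_def using P Q nP
      by (auto intro!: graph_Un graph_star simp: graph_def[of "{}"])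
    have "family_indep M G1" unfolding G1_def
      by (rule zero_extension) (use P nP family_indep_empty in \<open>auto simp: graph_def\<close>)
    then have "family_indep M G2" unfolding G2_def
      by (rule zero_extension[OF g(1)]) (use P nP in \<open>auto simp: G1_def star_def\<close>)
    then have "family_indep M G3" unfolding G3_def
      by (rule zero_extension[OF g(2)]) (use P nP in \<open>auto simp: G2_def G1_def star_def\<close>)
    then have "family_indep M G4" unfolding G4_def
      by (rule zero_extension[OF g(3)]) (use P Q nP ij(1) in \<open>auto simp: G3_def G2_def G1_def star_def\<close>)
    moreover have "D \<subseteq> G4"
    proof
      fix e assume e: "e \<in> D"
      then obtain a b where ab: "e = {a, b}" "a \<in> {1, 2, 3}" "b \<in> {4, 5, 6}"
        using D unfolding K33_def by blast
      show "e \<in> G4"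
      proof (cases "a = i")
        case True
        then have "b \<in> Q" using e ij ab by (auto simp: Q_def)
        then show ?thesis using True ab by (auto simp: G4_def star_def)
      next
        case False
        then have "a \<in> P" using ab by (auto simp: P_def)
        then have "e \<in> star b P" using ab by (auto simp: star_def)
        then show ?thesis using ab(3) by (auto simp: G4_def G3_def G2_def G1_def)
      qed
    qed
    ultimately show ?thesis using family_indep_subset[OF g(4)] by blast
  qed
  then show ?thesis using assms graph_K33 by (auto simp: circuit_def)
qed

lemma one_extension:
  fixes H :: "nat set set"
  assumes K33: "family_indep M K33"
    and H: "graph H" "family_indep M H" and uv: "{u, v} \<in> H" "u \<noteq> v"
    and w: "w \<noteq> u" "w \<noteq> v" and z: "z \<notin> verts H" "z \<noteq> w"
  shows "family_indep M (H - {{u, v}} \<union> star z {u, v, w})"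
proof (rule ccontr)
  let ?F = "H - {{u, v}}"
  assume dep: "\<not> family_indep M (?F \<union> star z {u, v, w})"
  \<comment> \<open>\<open>w\<close> is listed separately since it may lie outside
    \<open>verts H\<close>.\<close>
  have fin: "finite (verts H \<union> {w, z})" using finite_verts[OF H(1)] by simp
  obtain z2 where z2: "z2 \<notin> verts H \<union> {w, z}" using ex_new_if_finite[OF _ fin] by auto
  obtain z3 where z3: "z3 \<notin> verts H \<union> {w, z, z2}"
    using ex_new_if_finite[of "verts H \<union> {w, z, z2}"] fin by auto
  have uvH: "u \<in> verts H" "v \<in> verts H" using uv by auto
  then have dist: "u \<notin> {v, w, z, z2, z3}" "v \<notin> {w, z, z2, z3}" "w \<notin> {z, z2, z3}"
    "z \<notin> {z2, z3}" "z2 \<noteq> z3"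
    using z z2 z3 uv w by auto
  have graph_F: "graph (?F \<union> star y {u, v, w})" if "y \<in> {z, z2, z3}" for y
    using that dist by (intro graph_Un graph_star graph_subset[OF H(1)]) auto
  \<comment> \<open>By symmetry: renaming \<open>z\<close> to \<open>y\<close> fixes
    \<open>?F\<close> and the vertices \<open>u\<close>, \<open>v\<close>, \<open>w\<close>.\<close>
  have dep_all: "\<not> family_indep M (?F \<union> star y {u, v, w})" if y: "y \<in> {z, z2, z3}" for y
  proof -
    define f where "f = id(z := y)"
    have f_id: "f x = x" if "x \<noteq> z" for x using that by (simp add: f_def)
    have yH: "y \<notin> verts H \<union> {w}" using y z z2 z3 by auto
    have vs: "verts (?F \<union> star z {u, v, w}) \<subseteq> insert z (verts H \<union> {w})"
      using uvH by (auto simp: star_def)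
    have inj: "inj_on f (insert z (verts H \<union> {w}))"
      using yH by (auto simp: inj_on_def f_def)
    have F: "relabel f ?F = ?F" by (rule relabel_ident, rule f_id) (use z(1) in auto)
    have "relabel f (star z {u, v, w}) = star y {u, v, w}"
      using dist by (simp add: relabel_star f_def)
    then have "relabel f (?F \<union> star z {u, v, w}) = ?F \<union> star y {u, v, w}"
      using F by (simp add: relabel_Un)
    then show ?thesis
      using dep family_indep_relabel[OF graph_F inj_on_subset[OF inj vs]] by simp
  qed
  define J1 where "J1 = H \<union> star z {u, v}"
  define J2 where "J2 = J1 \<union> star z2 {u, v}"
  define J where "J = J2 \<union> star z3 {u, v}"
  have gJ: "graph J1" "graph J2" "graph J"
    unfolding J_def J2_def J1_def using dist H(1) by (auto intro!: graph_Un graph_star)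
  have "family_indep M J1" unfolding J1_def
    by (rule zero_extension[OF H]) (use z dist uv in auto)
  then have "family_indep M J2" unfolding J2_def
    by (rule zero_extension[OF gJ(1)]) (use z2 dist uv in \<open>auto simp: J1_def star_def\<close>)
  then have indJ: "family_indep M J" unfolding J_def
    by (rule zero_extension[OF gJ(2)]) (use z3 dist uv in \<open>auto simp: J2_def J1_def star_def\<close>)
  \<comment> \<open>\<open>A\<close> has two of the three edges at each new vertex. By
    \<open>dep_all\<close>, adding any one of the missing edges \<open>{y, w}\<close> makes it
    dependent.\<close>
  define A where "A = J - {{u, v}}"
  define K where "K = star z {u, v, w} \<union> star z2 {u, v, w} \<union> star z3 {u, v, w}"
  have gA: "graph A" using gJ(3) by (auto simp: A_def intro: graph_subset)
  have indA: "family_indep M A" by (rule family_indep_subset[OF gJ(3) indJ]) (auto simp: A_def)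
  have gK: "graph K" unfolding K_def using dist by (intro graph_Un graph_star) auto
  have indK: "family_indep M K"
  proof -
    define f :: "nat \<Rightarrow> nat" where
      "f = (\<lambda>x. if x = 1 then u else if x = 2 then v else if x = 3 then w
                 else if x = 4 then z else if x = 5 then z2 else z3)"
    have vK33: "verts K33 \<subseteq> {1, 2, 3, 4, 5, 6}" unfolding K33_stars star_def by simp
    have "inj_on f {1, 2, 3, 4, 5, 6}" using dist by (simp add: f_def)
    then have inj: "inj_on f (verts K33)" using vK33 by (rule inj_on_subset)
    have "relabel f K33 = K"
      unfolding K33_stars K_def by (simp add: relabel_Un relabel_star f_def insert_commute)
    then show ?thesis using family_indep_relabel[OF graph_K33 inj] K33 by simp
  qed
  \<comment> \<open>\<open>K\<close> has 9 = 2 * 6 - 3 edges, so it is a basis on its six vertices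
    and admits no further edge among them.\<close>
  have K_uv: "\<not> family_indep M (insert {u, v} K)"
  proof
    assume ind: "family_indep M (insert {u, v} K)"
    let ?X = "{u, v, w, z, z2, z3}"
    have "card ?X = 6" using dist by simp
    moreover have "insert {u, v} K \<subseteq> complete_graph ?X"
      using gK uv(2) by (auto simp: complete_graph_def graph_def K_def star_def)
    ultimately have "card (insert {u, v} K) \<le> 9"
      using card_family_indep_le[of ?X, OF _ _ _ ind] by simp
    moreover have "card K = 9"
    proof -
      have "star z {u, v, w} \<inter> star z2 {u, v, w} = {}"
        "(star z {u, v, w} \<union> star z2 {u, v, w}) \<inter> star z3 {u, v, w} = {}"
        using dist by (auto simp: star_def doubleton_eq_iff)
      then show ?thesis unfolding K_def using dist
        by (simp add: card_Un_disjoint card_star finite_star)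
    qed
    moreover have "{u, v} \<notin> K"
      using dist by (auto simp: K_def star_def doubleton_eq_iff)
    moreover have "finite K" using gK by (simp add: graph_def)
    ultimately show False by simp
  qed
  \<comment> \<open>\<open>K'\<close> is at least as large as \<open>J\<close>, yet cannot contain
    \<open>{u, v}\<close> and so lies in the union of \<open>K\<close> and \<open>A\<close>. Being
    larger than \<open>A\<close>, it supplies an edge that augments \<open>A\<close>, and this edge
    must be one of the forbidden \<open>{y, w}\<close>.\<close>
  obtain K' where K': "K \<subseteq> K'" "K' \<subseteq> K \<union> J" "family_indep M K'" "card J \<le> card K'"
    using family_indep_extend[OF gK indK gJ(3) indJ] by blast
  have gK': "graph K'" using K'(2) graph_Un[OF gK gJ(3)] by (rule graph_subset[rotated])
  have uvK': "{u, v} \<notin> K'"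
  proof
    assume "{u, v} \<in> K'"
    then show False using K_uv family_indep_subset[OF gK' K'(3), of "insert {u, v} K"] K'(1) by blast
  qed
  have "card A < card J"
    using gJ(3) uv(1) unfolding A_def J_def J2_def J1_def by (intro card_Diff1_less) (auto simp: graph_def)
  then obtain e where e: "e \<in> K' - A" "family_indep M (insert e A)"
    using family_indep_augment[OF gA indA gK' K'(3)] K'(4) by (metis order.strict_trans2)
  have "e \<noteq> {u, v}" using e uvK' by auto
  then have "e \<in> K - A" using e(1) K'(2) by (auto simp: A_def)
  moreover have "star y {u, v} \<subseteq> A" if "y \<in> {z, z2, z3}" for y
    using that dist by (auto simp: A_def J_def J2_def J1_def star_def doubleton_eq_iff)
  ultimately obtain y where y: "y \<in> {z, z2, z3}" "e = {y, w}"
    by (auto simp: K_def star_def)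
  have "?F \<union> star y {u, v, w} \<subseteq> insert e A"
    using y dist by (auto simp: A_def J_def J2_def J1_def star_def doubleton_eq_iff)
  moreover have "graph (insert e A)" using e(1) gK' gA by (auto simp: graph_def)
  ultimately show False using dep_all[OF y(1)] family_indep_subset[OF _ e(2)] by blast
qed

end

section \<open>Sparse graphs\<close>

definition induced :: "'a set set \<Rightarrow> 'a set \<Rightarrow> 'a set set" where
  "induced G X = {e \<in> G. e \<subseteq> X}"

text \<open>For an \<open>R_indep\<close> graph these are the sets attaining the sparsity bound. The
  additive form avoids truncated subtraction.\<close>

definition tight :: "'a set set \<Rightarrow> 'a set \<Rightarrow> bool" where
  "tight G X \<longleftrightarrow> finite X \<and> 2 \<le> card X \<and> card (induced G X) + 3 = 2 * card X"

lemma finite_induced: "graph G \<Longrightarrow> finite (induced G X)"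
  by (auto simp: induced_def graph_def)

lemma induced_empty:
  assumes "graph G" "finite X" "card X < 2"
  shows "induced G X = {}"
proof -
  have "\<not> e \<subseteq> X" if "e \<in> G" for e
  proof
    assume "e \<subseteq> X"
    then have "card e \<le> card X" using assms(2) by (rule card_mono[rotated])
    then show False using assms that by (simp add: graph_def)
  qed
  then show ?thesis by (auto simp: induced_def)
qed

text \<open>\<open>R_indep\<close> speaks only of subsets of \<open>verts G\<close>. Other elements
  of \<open>X\<close> induce no edges and only enlarge the bound; if fewer than two elements remain
  without them, no edge is induced.\<close>

lemma R_indepD:
  assumes G: "graph G" "R_indep G" and X: "finite X" "2 \<le> card X"
  shows "card (induced G X) + 3 \<le> 2 * card X"
proof -
  have eq: "induced G X = induced G (X \<inter> verts G)" by (auto simp: induced_def)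
  have le: "card (X \<inter> verts G) \<le> card X" using X by (intro card_mono) auto
  show ?thesis
  proof (cases "2 \<le> card (X \<inter> verts G)")
    case True
    then have "card (induced G (X \<inter> verts G)) \<le> 2 * card (X \<inter> verts G) - 3"
      using G(2) unfolding R_indep_def induced_def by blast
    then show ?thesis unfolding eq using le True by linarith
  next
    case False
    then show ?thesis using eq X induced_empty[OF G(1), of "X \<inter> verts G"] by simp
  qed
qed

lemma R_indep_subset:
  assumes "graph G" "R_indep G" "H \<subseteq> G"
  shows "R_indep H"
  unfolding R_indep_def
proof (intro allI impI)
  fix X assume X: "X \<subseteq> verts H" "2 \<le> card X"
  then have "X \<subseteq> verts G" using assms(3) by blast
  then have "card {e \<in> G. e \<subseteq> X} \<le> 2 * card X - 3"
    using assms(2) X(2) by (simp add: R_indep_def)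
  moreover have "card {e \<in> H. e \<subseteq> X} \<le> card {e \<in> G. e \<subseteq> X}"
    using assms by (intro card_mono) (auto simp: graph_def)
  ultimately show "card {e \<in> H. e \<subseteq> X} \<le> 2 * card X - 3" by simp
qed

text \<open>The number of induced edges is supermodular and the bound is modular, so equality for
  \<open>X\<close> and \<open>Y\<close> forces equality for their union. Two common vertices are
  what makes the bound valid on the intersection.\<close>

lemma tight_Un:
  assumes G: "graph G" "R_indep G" and X: "tight G X" and Y: "tight G Y" and "2 \<le> card (X \<inter> Y)"
  shows "tight G (X \<union> Y)"
proof -
  have fin: "finite X" "finite Y" using X Y by (auto simp: tight_def)
  have "card X \<le> card (X \<union> Y)" using fin by (intro card_mono) auto
  then have two: "2 \<le> card (X \<union> Y)" using X by (simp add: tight_def)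
  have "induced G X \<inter> induced G Y = induced G (X \<inter> Y)" by (auto simp: induced_def)
  then have "card (induced G X) + card (induced G Y)
      = card (induced G X \<union> induced G Y) + card (induced G (X \<inter> Y))"
    using card_Un_Int[OF finite_induced finite_induced] G(1) by metis
  moreover have "card (induced G X \<union> induced G Y) \<le> card (induced G (X \<union> Y))"
    by (intro card_mono finite_induced G(1)) (auto simp: induced_def)
  moreover have "card (induced G (X \<inter> Y)) + 3 \<le> 2 * card (X \<inter> Y)"
    using R_indepD[OF G] fin assms(5) by simp
  moreover have "card (induced G (X \<union> Y)) + 3 \<le> 2 * card (X \<union> Y)"
    using R_indepD[OF G] fin two by simp
  moreover have "card X + card Y = card (X \<union> Y) + card (X \<inter> Y)"
    using fin by (rule card_Un_Int)
  ultimately show ?thesis using X Y fin two by (simp add: tight_def)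
qed

text \<open>Pairwise intersections in one vertex make the induced edge sets disjoint. As
  \<open>b\<close> and \<open>c\<close> differ, the union has three vertices fewer than the sum of
  the sizes, and three deficits of 3 turn into 2 * 3 - 9 = -3, which is tightness.\<close>

lemma tight_triangle:
  assumes G: "graph G" "R_indep G" and tight: "tight G X" "tight G Y" "tight G Z"
    and int: "X \<inter> Y = {a}" "Y \<inter> Z = {b}" "X \<inter> Z = {c}" and "b \<noteq> c"
  shows "tight G (X \<union> Y \<union> Z)"
proof -
  have fin: "finite X" "finite Y" "finite Z" using tight by (auto simp: tight_def)
  have "card X \<le> card (X \<union> Y \<union> Z)" using fin by (intro card_mono) auto
  then have two: "2 \<le> card (X \<union> Y \<union> Z)" using tight(1) by (simp add: tight_def)
  have disj: "induced G P \<inter> induced G Q = {}" if "P \<inter> Q = {x}" for P Q x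
  proof -
    have "induced G P \<inter> induced G Q = induced G (P \<inter> Q)" by (auto simp: induced_def)
    then show ?thesis using that induced_empty[OF G(1), of "P \<inter> Q"] by simp
  qed
  have "card (induced G X \<union> induced G Y \<union> induced G Z)
      = card (induced G X) + card (induced G Y) + card (induced G Z)"
    using disj[OF int(1)] disj[OF int(2)] disj[OF int(3)] finite_induced[OF G(1)]
    by (subst card_Un_disjoint card_Un_disjoint; auto)+
  moreover have "card (induced G X \<union> induced G Y \<union> induced G Z) \<le> card (induced G (X \<union> Y \<union> Z))"
    by (intro card_mono finite_induced G(1)) (auto simp: induced_def)
  moreover have "card (induced G (X \<union> Y \<union> Z)) + 3 \<le> 2 * card (X \<union> Y \<union> Z)"
    using R_indepD[OF G] fin two by simp
  moreover have "card X + card Y = card (X \<union> Y) + 1"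
    using card_Un_Int[of X Y] fin int by simp
  moreover have "(X \<union> Y) \<inter> Z = {b, c}" using int by blast
  then have "card (X \<union> Y) + card Z = card (X \<union> Y \<union> Z) + 2"
    using card_Un_Int[of "X \<union> Y" Z] fin \<open>b \<noteq> c\<close> by simp
  ultimately show ?thesis using tight fin two by (simp add: tight_def)
qed

section \<open>Reductions of sparse graphs\<close>

text \<open>An edge of \<open>G\<close> is itself a tight set. Otherwise a set violating the bound
  after adding \<open>{a, b}\<close> must contain both ends, and since it gained only one edge it
  was tight before.\<close>

lemma blocked_pair:
  assumes G: "graph G" "R_indep G" and "a \<noteq> b" and blocked: "{a, b} \<in> G \<or> \<not> R_indep (insert {a, b} G)"
  obtains X where "tight G X" "a \<in> X" "b \<in> X" "X \<subseteq> verts G \<union> {a, b}"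
proof (cases "{a, b} \<in> G")
  case True
  have "induced G {a, b} = {{a, b}}"
  proof
    show "induced G {a, b} \<subseteq> {{a, b}}"
    proof
      fix e assume "e \<in> induced G {a, b}"
      then have "e \<subseteq> {a, b}" "card e = card {a, b}"
        using G(1) \<open>a \<noteq> b\<close> by (auto simp: induced_def graph_def)
      then show "e \<in> {{a, b}}" using card_subset_eq[of "{a, b}" e] by auto
    qed
  qed (use True in \<open>auto simp: induced_def\<close>)
  then have "tight G {a, b}" using \<open>a \<noteq> b\<close> by (simp add: tight_def)
  then show ?thesis using that by blast
next
  case False
  let ?H = "insert {a, b} G"
  have gH: "graph ?H" using G(1) \<open>a \<noteq> b\<close> by (auto simp: graph_def)
  obtain X where X: "X \<subseteq> verts ?H" "2 \<le> card X" "\<not> card (induced ?H X) \<le> 2 * card X - 3"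
    using blocked False by (auto simp: R_indep_def induced_def)
  have fin: "finite X" using X(2) by (metis card.infinite not_numeral_le_zero)
  have le: "card (induced G X) + 3 \<le> 2 * card X" by (rule R_indepD[OF G fin X(2)])
  have ab: "{a, b} \<subseteq> X"
  proof (rule ccontr)
    assume "\<not> {a, b} \<subseteq> X"
    then have "induced ?H X = induced G X" by (auto simp: induced_def)
    then show False using X(3) le by simp
  qed
  then have "induced ?H X = insert {a, b} (induced G X)" by (auto simp: induced_def)
  then have "card (induced ?H X) \<le> card (induced G X) + 1"
    by (simp add: card_insert_if finite_induced[OF G(1)])
  then have "tight G X" using X le fin by (simp add: tight_def)
  then show ?thesis using that[of X] ab X(1) by auto
qed

text \<open>If all three pairs were blocked, the tight sets blocking them would combine to a tight set
  containing \<open>u, v, w\<close>, to which \<open>z\<close> adds three edges.\<close>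

lemma one_reduction:
  assumes G: "graph G" and z: "z \<notin> verts G" "z \<notin> {u, v, w}"
    and dist: "u \<noteq> v" "v \<noteq> w" "u \<noteq> w" and R: "R_indep (G \<union> star z {u, v, w})"
  obtains a b c where "{a, b, c} = {u, v, w}" "a \<noteq> b" "c \<noteq> a" "c \<noteq> b" "{a, b} \<notin> G" "R_indep (insert {a, b} G)"
proof (rule ccontr)
  note witness = that
  assume no_witness: "\<not> thesis"
  have blocked: "{a, b} \<in> G \<or> \<not> R_indep (insert {a, b} G)"
    if "{a, b, c} = {u, v, w}" "a \<noteq> b" "c \<noteq> a" "c \<noteq> b" for a b c
    using witness[OF that] no_witness by blast
  let ?H = "G \<union> star z {u, v, w}"
  have gH: "graph ?H" using z(2) by (intro graph_Un G graph_star) auto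
  have RG: "R_indep G" by (rule R_indep_subset[OF gH R]) auto
  have no: "\<not> {u, v, w} \<subseteq> X" if X: "tight G X" "z \<notin> X" for X
  proof
    assume sub: "{u, v, w} \<subseteq> X"
    have fin: "finite X" using X by (simp add: tight_def)
    have "induced G X \<union> star z {u, v, w} \<subseteq> induced ?H (insert z X)"
      using sub by (auto simp: induced_def star_def)
    then have "card (induced G X \<union> star z {u, v, w}) \<le> card (induced ?H (insert z X))"
      by (intro card_mono finite_induced gH)
    moreover have "card (induced G X \<union> star z {u, v, w}) = card (induced G X) + card (star z {u, v, w})"
      using X(2) by (intro card_Un_disjoint finite_induced G) (auto simp: star_def induced_def)
    moreover have "card (star z {u, v, w}) = 3" using dist by (simp add: card_star)
    moreover have "card (induced ?H (insert z X)) + 3 \<le> 2 * card (insert z X)"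
      using fin X by (intro R_indepD[OF gH R]) (auto simp: tight_def)
    ultimately show False using X fin by (simp add: tight_def)
  qed
  obtain X where X: "tight G X" "u \<in> X" "v \<in> X" "X \<subseteq> verts G \<union> {u, v}"
    using blocked_pair[OF G RG dist(1) blocked[of u v w]] dist by auto
  obtain Y where Y: "tight G Y" "v \<in> Y" "w \<in> Y" "Y \<subseteq> verts G \<union> {v, w}"
    using blocked_pair[OF G RG dist(2) blocked[of v w u]] dist by auto
  obtain Z where Z: "tight G Z" "u \<in> Z" "w \<in> Z" "Z \<subseteq> verts G \<union> {u, w}"
    using blocked_pair[OF G RG dist(3) blocked[of u w v]] dist by auto
  have zXYZ: "z \<notin> X" "z \<notin> Y" "z \<notin> Z" using X Y Z z by auto
  \<comment> \<open>If two blocking sets shared two vertices, \<open>tight_Un\<close> would already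
    give a tight set containing \<open>u\<close>, \<open>v\<close>, \<open>w\<close>. Hence they
    meet exactly as \<open>tight_triangle\<close> requires.\<close>
  have single: "P \<inter> Q = {x}"
    if "tight G P" "tight G Q" "z \<notin> P" "z \<notin> Q" "x \<in> P" "x \<in> Q" "{u, v, w} \<subseteq> P \<union> Q" for P Q x
  proof -
    have "\<not> 2 \<le> card (P \<inter> Q)" using tight_Un[OF G RG that(1,2)] no[of "P \<union> Q"] that by auto
    moreover have "0 < card (P \<inter> Q)" using that(1,5,6) by (auto simp: tight_def card_gt_0_iff)
    ultimately have "card (P \<inter> Q) = 1" by linarith
    then show ?thesis using that(5,6) by (metis IntI card_1_singletonE singletonD)
  qed
  have "X \<inter> Y = {v}" "Y \<inter> Z = {w}" "X \<inter> Z = {u}"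
    using single[OF X(1) Y(1) zXYZ(1,2) X(3) Y(2)] single[OF Y(1) Z(1) zXYZ(2,3) Y(3) Z(3)]
      single[OF X(1) Z(1) zXYZ(1,3) X(2) Z(2)] X Y Z by auto
  then have "tight G (X \<union> Y \<union> Z)"
    using tight_triangle[OF G RG X(1) Y(1) Z(1)] dist by metis
  then show False using no[of "X \<union> Y \<union> Z"] X Y Z zXYZ by auto
qed

text \<open>The degrees sum to twice the number of edges, at most
  \<open>4 * card (verts G) - 6\<close>, so the average degree is below 4.\<close>

lemma low_degree_vertex:
  assumes G: "graph G" "R_indep G" "G \<noteq> {}"
  obtains z where "z \<in> verts G" "card {e \<in> G. z \<in> e} \<le> 3"
proof -
  have fin: "finite G" "finite (verts G)" using G finite_verts by (auto simp: graph_def)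
  have two: "2 \<le> card (verts G)" by (rule card_verts_ge_2[OF G(1,3)])
  have "induced G (verts G) = G" by (auto simp: induced_def)
  then have le: "card G + 3 \<le> 2 * card (verts G)" using R_indepD[OF G(1,2) fin(2) two] by simp
  have "(\<Sum>z\<in>verts G. card {e \<in> G. z \<in> e}) = (\<Sum>e\<in>G. 2)"
  proof -
    have "(\<Sum>z\<in>verts G. card {e \<in> G. z \<in> e}) = 2 * card G"
    proof (rule sum_multicount[OF fin(2,1)], rule ballI)
      fix e assume e: "e \<in> G"
      then have "{i \<in> verts G. i \<in> e} = e" by auto
      then show "card {i \<in> verts G. i \<in> e} = 2" using e G(1) by (simp add: graph_def)
    qed
    then show ?thesis by simp
  qed
  then have sum: "(\<Sum>z\<in>verts G. card {e \<in> G. z \<in> e}) < 4 * card (verts G)" using le by simp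
  have "\<exists>z\<in>verts G. card {e \<in> G. z \<in> e} \<le> 3"
  proof (rule ccontr)
    assume "\<not> ?thesis"
    then have "4 \<le> card {e \<in> G. z \<in> e}" if "z \<in> verts G" for z
      using that by force
    then have "(\<Sum>z\<in>verts G. 4) \<le> (\<Sum>z\<in>verts G. card {e \<in> G. z \<in> e})"
      by (rule sum_mono)
    then show False using sum by simp
  qed
  then show ?thesis using that by blast
qed

section \<open>Comparing the two families\<close>

context rigidity_family begin

text \<open>The part of \<open>G\<close> induced on \<open>X\<close> is independent in a matroid of
  rank \<open>2 * card X - 3\<close>.\<close>

lemma family_indep_imp_R_indep:
  fixes G :: "'a set set"
  assumes G: "graph G" "family_indep M G"
  shows "R_indep G"
  unfolding R_indep_def
proof (intro allI impI)
  fix X assume X: "X \<subseteq> verts G" "2 \<le> card X"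
  then have "finite X" using finite_verts[OF G(1)] finite_subset by blast
  moreover have "family_indep M {e \<in> G. e \<subseteq> X}" by (rule family_indep_subset[OF G]) auto
  ultimately show "card {e \<in> G. e \<subseteq> X} \<le> 2 * card X - 3"
    using G(1) X by (intro card_family_indep_le) (auto simp: complete_graph_def graph_def)
qed

text \<open>Henneberg induction on the number of edges: a vertex of degree at most 3 is removed and
  put back by a 0-extension, or by a 1-extension inverse to \<open>one_reduction\<close> when the
  degree is 3.\<close>

lemma R_indep_imp_family_indep_nat:
  fixes G :: "nat set set"
  assumes K33: "family_indep M K33" and G: "graph G" "R_indep G"
  shows "family_indep M G"
  using G
proof (induction "card G" arbitrary: G rule: less_induct)
  case less
  show ?case
  proof (cases "G = {}")
    case True
    then show ?thesis by (simp add: family_indep_empty)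
  next
    case False
    have finG: "finite G" using less.prems by (simp add: graph_def)
    obtain z0 where "z0 \<in> verts G" "card {e \<in> G. z0 \<in> e} \<le> 3"
      using low_degree_vertex[OF less.prems False] .
    then obtain z where z: "z \<in> verts G" "card {e \<in> G. z \<in> e} \<le> 3" by blast
    obtain S where S: "z \<notin> S" "finite S" "G = {e \<in> G. z \<notin> e} \<union> star z S"
      "card {e \<in> G. z \<in> e} = card S"
      using star_decomposition[OF less.prems(1), of z] .
    define H where "H = {e \<in> G. z \<notin> e}"
    have G_eq: "G = H \<union> star z S" using S(3) by (simp add: H_def)
    have HG: "H \<subseteq> G" and gH: "graph H" and zH: "z \<notin> verts H" and RH: "R_indep H"
      using less.prems graph_subset[of G H] R_indep_subset[of G H] by (auto simp: H_def)
    have cG: "card G = card H + card S"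
    proof -
      have "card G = card H + card {e \<in> G. z \<in> e}"
        unfolding H_def using finG
        by (subst card_Un_disjoint[symmetric]) (auto intro: arg_cong[where f = card])
      then show ?thesis using S(4) by simp
    qed
    \<comment> \<open>Graphs have no isolated vertices, so deleting \<open>z\<close> really
      decreases the number of edges.\<close>
    have "S \<noteq> {}" using z(1) zH G_eq by (auto simp: star_def)
    then have S1: "1 \<le> card S" using S(2) by (simp add: Suc_le_eq card_gt_0_iff)
    show ?thesis
    proof (cases "card S \<le> 2")
      case True
      have "family_indep M H" using less.hyps[OF _ gH RH] cG S1 by simp
      then show ?thesis using zero_extension[OF gH _ zH S(1,2) True] G_eq by simp
    next
      case False
      then have "card S = 3" using z(2) S(4) by simp
      then obtain u v w where uvw: "S = {u, v, w}" "u \<noteq> v" "v \<noteq> w" "u \<noteq> w"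
        by (auto simp: card_3_iff)
      obtain a b c where abc: "{a, b, c} = {u, v, w}" "a \<noteq> b" "c \<noteq> a" "c \<noteq> b"
          "{a, b} \<notin> H" "R_indep (insert {a, b} H)"
        using one_reduction[OF gH zH _ uvw(2-4)] S(1) uvw(1) less.prems(2) G_eq by metis
      let ?H = "insert {a, b} H"
      have g: "graph ?H" using gH abc(2) by (auto simp: graph_def)
      have abcS: "S = {a, b, c}" using abc(1) uvw(1) by simp
      \<comment> \<open>Three edges are lost and one is gained.\<close>
      have "card ?H < card G" using cG \<open>card S = 3\<close> gH by (simp add: card_insert_if graph_def)
      then have "family_indep M ?H" using less.hyps[OF _ g abc(6)] by simp
      then have "family_indep M (?H - {{a, b}} \<union> star z {a, b, c})"
        using abc zH S(1) abcS by (intro one_extension[OF K33 g]) auto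
      then show ?thesis using G_eq abcS abc(5) by simp
    qed
  qed
qed

text \<open>Since the extension arguments take place over \<open>nat\<close>, the graph is first
  copied there; injective relabelling preserves both kinds of independence.\<close>

lemma R_indep_imp_family_indep:
  fixes G :: "'a set set"
  assumes K33: "family_indep M K33" and G: "graph G" "R_indep G"
  shows "family_indep M G"
proof -
  obtain f :: "'a \<Rightarrow> nat" where f: "inj_on f (verts G)"
    using finite_imp_inj_to_nat_seg[OF finite_verts[OF G(1)]] by blast
  have "R_indep (relabel f G)"
    unfolding R_indep_def
  proof (intro allI impI)
    fix X assume X: "X \<subseteq> verts (relabel f G)" "2 \<le> card X"
    then obtain Y where Y: "Y \<subseteq> verts G" "X = f ` Y" by (auto simp: verts_relabel subset_image_iff)
    have "card X = card Y" using Y f by (auto intro: card_image inj_on_subset)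
    moreover have "f ` e \<subseteq> f ` Y \<longleftrightarrow> e \<subseteq> Y" if "e \<in> G" for e
      using inj_on_image_mem_iff[OF f _ Y(1)] that by blast
    then have "{e \<in> relabel f G. e \<subseteq> X} = relabel f {e \<in> G. e \<subseteq> Y}"
      using Y(2) by (auto simp: relabel_def)
    moreover have "card (relabel f {e \<in> G. e \<subseteq> Y}) = card {e \<in> G. e \<subseteq> Y}"
      by (rule card_relabel, rule inj_on_subset[OF f]) auto
    ultimately show "card {e \<in> relabel f G. e \<subseteq> X} \<le> 2 * card X - 3"
      using G(2) X(2) Y(1) by (simp add: R_indep_def)
  qed
  then have "family_indep M (relabel f G)"
    by (rule R_indep_imp_family_indep_nat[OF K33 graph_relabel[OF G(1) f]])
  then show ?thesis using family_indep_relabel[OF G(1) f] by simp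
qed

end

theorem theorem4p2:
  fixes M :: "nat \<Rightarrow> nat set set \<Rightarrow> bool" and C :: "'a set set"
  assumes "two_rigidity_family M"
    and "\<not> circuit (family_indep M) K33"
    and "circuit (family_indep M) C"
  shows "circuit R_indep C"
proof -
  interpret rigidity_family M using assms(1) by unfold_locales
  have K33: "family_indep M K33" using assms(2) by (rule K33_indep)
  have C: "graph C" "\<not> family_indep M C" "\<And>D. D \<subset> C \<Longrightarrow> family_indep M D"
    using assms(3) by (auto simp: circuit_def)
  \<comment> \<open>The two notions agree on graphs; one implication gives dependence of
    \<open>C\<close>, the other independence of its proper subgraphs.\<close>
  have "\<not> R_indep C" using R_indep_imp_family_indep[OF K33 C(1)] C(2) by blast
  moreover have "R_indep D" if "D \<subset> C" for D
    using family_indep_imp_R_indep[of D] C(3)[OF that] graph_subset[OF C(1)] that by blast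
  ultimately show ?thesis using C(1) by (simp add: circuit_def)
qed

end
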